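(* Let $A:H^2\rightarrow H^2$ be a bounded linear operator such that $A(\mathcal{O})\subset\mathcal{O}$. Then there exist an analytic function $\varphi:\mathbb{D}\rightarrow\mathbb{D}$ and a function $\psi\in\mathcal{O}$ such that $A=M_\psi C_\varphi$, i.e. $(Af)(z)=\psi(z)\,f(\varphi(z))$ for all $f\in H^2$ and $z\in\mathbb{D}$.
   Context: $\mathbb{D}$ is the open unit disk in $\mathbb{C}$ and $H^2=H^2(\mathbb{D})$ is the Hardy-Hilbert space of analytic functions on $\mathbb{D}$ (those with square-summable Taylor coefficients at $0$). A function $f\in H^2$ is outer if it is a cyclic vector of the unilateral shift, that is, if the linear span of the functions $z^nf(z)$, $n\geq0$, is dense in $H^2$. $\mathcal{O}\subset H^2$ is the set of all outer functions. $M_\psi$ denotes multiplication by $\psi$, and $C_\varphi f=f\circ\varphi$. *)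

theory Defs
  imports "HOL-Complex_Analysis.Complex_Analysis"
begin

abbreviation unit_disc :: "complex set" where
  "unit_disc \<equiv> ball 0 1"

definition taylor_coeff :: "(complex \<Rightarrow> complex) \<Rightarrow> nat \<Rightarrow> complex" where
  "taylor_coeff f n = fps_nth (fps_expansion f 0) n"

text \<open>
  A function on the disc is represented by its extension by zero to the whole complex plane, so
  that two elements of the Hardy space are equal iff they agree on the disc.
\<close>

definition hardy_functions :: "(complex \<Rightarrow> complex) set" where
  "hardy_functions =
     {f. f holomorphic_on unit_disc \<and> (\<forall>z. z \<notin> unit_disc \<longrightarrow> f z = 0) \<and>
         summable (\<lambda>n. (cmod (taylor_coeff f n))\<^sup>2)}"

lemma has_fps_expansion_taylor:
  assumes "f holomorphic_on unit_disc"
  shows "f has_fps_expansion fps_expansion f 0"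
  by (rule has_fps_expansion_fps_expansion[OF _ _ assms]) auto

lemma taylor_coeff_eqI: "f has_fps_expansion F \<Longrightarrow> taylor_coeff f n = fps_nth F n"
  by (simp add: fps_expansion_eqI taylor_coeff_def)

lemma taylor_coeff_add:
  assumes "f holomorphic_on unit_disc" "g holomorphic_on unit_disc"
  shows "taylor_coeff (\<lambda>z. f z + g z) n = taylor_coeff f n + taylor_coeff g n"
  using taylor_coeff_eqI[OF has_fps_expansion_add[OF assms[THEN has_fps_expansion_taylor]]]
  by (simp add: taylor_coeff_def)

lemma taylor_coeff_cmult:
  assumes "f holomorphic_on unit_disc"
  shows "taylor_coeff (\<lambda>z. c * f z) n = c * taylor_coeff f n"
  using taylor_coeff_eqI[OF has_fps_expansion_cmult_left[OF assms[THEN has_fps_expansion_taylor]]]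
  by (simp add: taylor_coeff_def)

lemma taylor_coeff_zero [simp]: "taylor_coeff (\<lambda>z. 0) n = 0"
  using taylor_coeff_eqI[OF has_fps_expansion_0] by simp

lemma taylor_coeff_shift:
  assumes "f holomorphic_on unit_disc"
  shows "taylor_coeff (\<lambda>z. z * f z) n = (if n = 0 then 0 else taylor_coeff f (n - 1))"
  using taylor_coeff_eqI[OF has_fps_expansion_mult[OF has_fps_expansion_fps_X
          assms[THEN has_fps_expansion_taylor]]]
  by (simp add: taylor_coeff_def)

lemma taylor_sums:
  assumes "f holomorphic_on unit_disc" "z \<in> unit_disc"
  shows "(\<lambda>n. taylor_coeff f n * z ^ n) sums f z"
  using holomorphic_power_series[OF assms]
  by (simp add: taylor_coeff_def fps_expansion_def)

lemma summable_square_add: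
  fixes a b :: "nat \<Rightarrow> complex"
  assumes "summable (\<lambda>n. (cmod (a n))\<^sup>2)" "summable (\<lambda>n. (cmod (b n))\<^sup>2)"
  shows "summable (\<lambda>n. (cmod (a n + b n))\<^sup>2)"
proof (rule summable_comparison_test')
  show "summable (\<lambda>n. 2 * (cmod (a n))\<^sup>2 + 2 * (cmod (b n))\<^sup>2)"
    using assms by (intro summable_add summable_mult)
  show "norm ((cmod (a n + b n))\<^sup>2) \<le> 2 * (cmod (a n))\<^sup>2 + 2 * (cmod (b n))\<^sup>2" for n
  proof -
    have "(cmod (a n + b n))\<^sup>2 \<le> (cmod (a n) + cmod (b n))\<^sup>2"
      by (intro power_mono norm_triangle_ineq) auto
    also have "\<dots> \<le> 2 * (cmod (a n))\<^sup>2 + 2 * (cmod (b n))\<^sup>2"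
      using sum_squares_bound[of "cmod (a n)" "cmod (b n)"] by (simp add: power2_sum)
    finally show ?thesis by simp
  qed
qed

lemma summable_inner:
  fixes a b :: "nat \<Rightarrow> complex"
  assumes "summable (\<lambda>n. (cmod (a n))\<^sup>2)" "summable (\<lambda>n. (cmod (b n))\<^sup>2)"
  shows "summable (\<lambda>n. a n \<bullet> b n)"
proof (rule summable_comparison_test')
  show "summable (\<lambda>n. (cmod (a n))\<^sup>2 + (cmod (b n))\<^sup>2)"
    using assms by (rule summable_add)
  show "norm (a n \<bullet> b n) \<le> (cmod (a n))\<^sup>2 + (cmod (b n))\<^sup>2" for n
  proof -
    have "norm (a n \<bullet> b n) \<le> cmod (a n) * cmod (b n)"
      using Cauchy_Schwarz_ineq2[of "a n" "b n"] by simp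
    also have "\<dots> \<le> (cmod (a n))\<^sup>2 + (cmod (b n))\<^sup>2"
      using sum_squares_bound[of "cmod (a n)" "cmod (b n)"] norm_ge_zero[of "a n * b n"]
      unfolding norm_mult by linarith
    finally show ?thesis .
  qed
qed

lemma hardy_functions_zero: "(\<lambda>z. 0) \<in> hardy_functions"
  by (simp add: hardy_functions_def)

lemma hardy_functions_add:
  "f \<in> hardy_functions \<Longrightarrow> g \<in> hardy_functions \<Longrightarrow> (\<lambda>z. f z + g z) \<in> hardy_functions"
  by (auto simp: hardy_functions_def taylor_coeff_add
      intro!: holomorphic_intros summable_square_add)

lemma hardy_functions_cmult: "f \<in> hardy_functions \<Longrightarrow> (\<lambda>z. c * f z) \<in> hardy_functions"
  by (auto simp: hardy_functions_def taylor_coeff_cmult norm_mult power_mult_distrib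
      intro!: holomorphic_intros summable_mult)

lemma hardy_functions_shift: "f \<in> hardy_functions \<Longrightarrow> (\<lambda>z. z * f z) \<in> hardy_functions"
  by (subst hardy_functions_def, subst summable_Suc_iff [symmetric])
    (auto simp: hardy_functions_def taylor_coeff_shift intro!: holomorphic_intros)

typedef hardy = hardy_functions
  morphisms hfun Abs_hardy
  using hardy_functions_zero by blast

setup_lifting type_definition_hardy

lemma hfun_holomorphic: "hfun f holomorphic_on unit_disc"
  and hfun_outside: "z \<notin> unit_disc \<Longrightarrow> hfun f z = 0"
  and summable_hfun: "summable (\<lambda>n. (cmod (taylor_coeff (hfun f) n))\<^sup>2)"
  using hfun[of f] by (auto simp: hardy_functions_def)

lift_definition scaleC :: "complex \<Rightarrow> hardy \<Rightarrow> hardy" is "\<lambda>c f z. c * f z"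
  by (rule hardy_functions_cmult)

lift_definition shift :: "hardy \<Rightarrow> hardy" is "\<lambda>f z. z * f z"
  by (rule hardy_functions_shift)

instantiation hardy :: real_vector
begin

lift_definition zero_hardy :: hardy is "\<lambda>z. 0"
  by (rule hardy_functions_zero)

lift_definition plus_hardy :: "hardy \<Rightarrow> hardy \<Rightarrow> hardy" is "\<lambda>f g z. f z + g z"
  by (rule hardy_functions_add)

lift_definition uminus_hardy :: "hardy \<Rightarrow> hardy" is "\<lambda>f z. - f z"
  using hardy_functions_cmult[of _ "- 1"] by simp

lift_definition minus_hardy :: "hardy \<Rightarrow> hardy \<Rightarrow> hardy" is "\<lambda>f g z. f z - g z"
  using hardy_functions_add[OF _ hardy_functions_cmult[of _ "- 1"]] by simp

lift_definition scaleR_hardy :: "real \<Rightarrow> hardy \<Rightarrow> hardy" is "\<lambda>r f z. r *\<^sub>R f z"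
  by (simp add: scaleR_conv_of_real hardy_functions_cmult)

instance
  by standard (transfer, simp add: fun_eq_iff algebra_simps)+

end

interpretation hardy: vector_space scaleC
  by standard (transfer, simp add: fun_eq_iff algebra_simps)+

lemma hfun_simps [simp]:
  "hfun 0 z = 0" "hfun (f + g) z = hfun f z + hfun g z" "hfun (- f) z = - hfun f z"
  "hfun (f - g) z = hfun f z - hfun g z" "hfun (r *\<^sub>R f) z = complex_of_real r * hfun f z"
  "hfun (scaleC c f) z = c * hfun f z" "hfun (shift f) z = z * hfun f z"
  by (transfer, simp add: scaleR_conv_of_real)+

lemma hfun_funpow_shift: "hfun ((shift ^^ n) f) z = z ^ n * hfun f z"
  by (induction n) (simp_all add: mult.assoc)

lemma taylor_coeff_hfun_add:
  "taylor_coeff (hfun (f + g)) n = taylor_coeff (hfun f) n + taylor_coeff (hfun g) n"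
  using taylor_coeff_add[OF hfun_holomorphic hfun_holomorphic, of f g n]
  by (simp add: plus_hardy.rep_eq)

lemma taylor_coeff_hfun_scaleR:
  "taylor_coeff (hfun (r *\<^sub>R f)) n = r *\<^sub>R taylor_coeff (hfun f) n"
  using taylor_coeff_cmult[OF hfun_holomorphic, of "complex_of_real r" f n]
  by (simp add: scaleR_hardy.rep_eq scaleR_conv_of_real)

lemma hardy_eqI:
  assumes "\<And>n. taylor_coeff (hfun f) n = taylor_coeff (hfun g) n"
  shows "f = g"
proof (rule hfun_inject [THEN iffD1], rule ext)
  fix z
  show "hfun f z = hfun g z"
  proof (cases "z \<in> unit_disc")
    case True
    then show ?thesis
      using taylor_sums[OF hfun_holomorphic True, of f] taylor_sums[OF hfun_holomorphic True, of g]
      by (simp add: assms sums_unique2)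
  qed (simp add: hfun_outside)
qed

text \<open>
  Library inner product spaces are real, so \<open>inner\<close> is the real part of the complex inner product
  \<open>\<Sum>n. a\<^sub>n * cnj b\<^sub>n\<close>; the norm and the topology it induces are those of the Hardy space.
\<close>

instantiation hardy :: real_inner
begin

definition inner_hardy :: "hardy \<Rightarrow> hardy \<Rightarrow> real" where
  "f \<bullet> g = (\<Sum>n. taylor_coeff (hfun f) n \<bullet> taylor_coeff (hfun g) n)"

definition norm_hardy :: "hardy \<Rightarrow> real" where
  "norm f = sqrt (\<Sum>n. (cmod (taylor_coeff (hfun f) n))\<^sup>2)"

definition sgn_hardy :: "hardy \<Rightarrow> hardy" where
  "sgn (f :: hardy) = f /\<^sub>R norm f"

definition dist_hardy :: "hardy \<Rightarrow> hardy \<Rightarrow> real" where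
  "dist (f :: hardy) g = norm (f - g)"

definition uniformity_hardy :: "(hardy \<times> hardy) filter" where
  "uniformity = (INF e\<in>{0<..}. principal {(f, g :: hardy). dist f g < e})"

definition open_hardy :: "hardy set \<Rightarrow> bool" where
  "open U = (\<forall>f\<in>U. \<forall>\<^sub>F (f', g) in uniformity. f' = f \<longrightarrow> (g :: hardy) \<in> U)"

instance
proof
  fix f g h :: hardy and r :: real and U :: "hardy set"
  show "dist f g = norm (f - g)" by (rule dist_hardy_def)
  show "sgn f = f /\<^sub>R norm f" by (rule sgn_hardy_def)
  show "uniformity = (INF e\<in>{0<..}. principal {(f, g :: hardy). dist f g < e})"
    by (rule uniformity_hardy_def)
  show "open U = (\<forall>f\<in>U. \<forall>\<^sub>F (f', g) in uniformity. f' = f \<longrightarrow> g \<in> U)"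
    by (rule open_hardy_def)
  show "f \<bullet> g = g \<bullet> f"
    by (simp add: inner_hardy_def inner_commute)
  show "(f + g) \<bullet> h = f \<bullet> h + g \<bullet> h"
    unfolding inner_hardy_def taylor_coeff_hfun_add inner_add_left
    by (intro suminf_add [symmetric] summable_inner summable_hfun)
  show "(r *\<^sub>R f) \<bullet> g = r * (f \<bullet> g)"
    unfolding inner_hardy_def taylor_coeff_hfun_scaleR inner_scaleR_left
    by (intro suminf_mult summable_inner summable_hfun)
  show "0 \<le> f \<bullet> f"
    unfolding inner_hardy_def by (intro suminf_nonneg summable_inner summable_hfun) auto
  show "norm f = sqrt (f \<bullet> f)"
    by (simp add: norm_hardy_def inner_hardy_def power2_norm_eq_inner)
  show "f \<bullet> f = 0 \<longleftrightarrow> f = 0"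
  proof
    assume "f \<bullet> f = 0"
    then have "\<forall>n. taylor_coeff (hfun f) n \<bullet> taylor_coeff (hfun f) n = 0"
      unfolding inner_hardy_def
      by (subst (asm) suminf_eq_zero_iff) (auto intro: summable_inner summable_hfun)
    then show "f = 0"
      by (intro hardy_eqI) (simp add: zero_hardy.rep_eq)
  qed (simp add: inner_hardy_def zero_hardy.rep_eq)
qed

end

definition outer :: "hardy set" where
  "outer = {f. closure (hardy.span {(shift ^^ n) f | n. True}) = UNIV}"

end

theory Submission
  imports Defs
begin

text \<open>
  Fix \<open>z\<close> in the disc. Outer functions have no zeros there, so \<open>L f = (A f)(z)\<close> is a bounded functional
  that does not vanish on outer functions. The functions \<open>exp (\<lambda> z)\<close> are outer, hence
  \<open>\<lambda> \<mapsto> L (exp (\<lambda> z))\<close> is a zero-free entire function of exponential type, that is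
  \<open>c exp (b \<lambda>)\<close>. Comparing coefficients gives \<open>L (z ^ n) = c b ^ n\<close>; boundedness of \<open>L\<close> forces
  \<open>\<bar>b\<bar> < 1\<close>, and by density of the polynomials \<open>L\<close> is \<open>c\<close> times evaluation at \<open>b =: \<phi>(z)\<close>.
\<close>

section \<open>Zero-free entire functions of exponential type\<close>

text \<open>Since the plane is simply connected, \<open>F\<close> has a holomorphic logarithm. The
  growth of \<open>F\<close> bounds its real part linearly from above, Borel-Caratheodory upgrades
  this to a linear bound on the modulus, and Liouville makes the logarithm affine.\<close>

lemma zero_free_exponential_type:
  fixes F :: "complex \<Rightarrow> complex"
  assumes holF: "F holomorphic_on UNIV" and nz: "\<And>z. F z \<noteq> 0"
    and bound: "\<And>z::complex. cmod (F z) \<le> K * exp (cmod z)"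
  obtains b where "\<And>z::complex. F z = F 0 * exp (b * z)"
proof -
  obtain g where holg: "g holomorphic_on UNIV" and g: "\<And>z. exp (g z) = F z"
    using holomorphic_logarithm_exists[of UNIV F 0] holF nz by auto
  define h where "h z = g z - g 0" for z :: complex
  have holh: "h holomorphic_on UNIV" and h0: "h 0 = 0"
    unfolding h_def by (auto intro!: holomorphic_intros holg)
  have F_h: "F z = F 0 * exp (h z)" for z :: complex
    by (simp add: h_def exp_diff g nz)
  \<comment> \<open>\<open>ln (K / cmod (F 0))\<close> is what the growth bound yields for
    \<open>Re (h z) - cmod z\<close>. Taking the maximum with 0 makes \<open>A\<close> below
    positive and allows \<open>2 * M \<le> 2 * M * cmod z\<close> when
    \<open>cmod z \<ge> 1\<close>.\<close>
  define M where "M = max 0 (ln (K / cmod (F 0)))"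
  have M0: "M \<ge> 0" by (simp add: M_def)
  have Re_h: "Re (h z) \<le> M + cmod z" for z :: complex
  proof -
    have F0: "cmod (F 0) > 0" using nz by simp
    have "cmod (F 0) * exp (Re (h z)) \<le> K * exp (cmod z)"
      using bound[of z] by (subst (asm) F_h) (simp add: norm_mult)
    then have le: "exp (Re (h z)) \<le> K / cmod (F 0) * exp (cmod z)"
      using F0 by (simp add: field_simps)
    moreover have K: "K / cmod (F 0) > 0"
      using less_le_trans[OF exp_gt_zero le] F0 by (simp add: zero_less_mult_iff zero_less_divide_iff)
    ultimately have "Re (h z) \<le> ln (K / cmod (F 0) * exp (cmod z))"
      by (metis exp_gt_zero exp_le_cancel_iff exp_ln mult_pos_pos)
    also have "\<dots> = ln (K / cmod (F 0)) + cmod z"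
      using ln_mult_pos[OF K exp_gt_zero[of "cmod z"]] by (simp del: times_divide_eq_left)
    finally show ?thesis by (simp add: M_def)
  qed
  have h_growth: "cmod (h z) \<le> (2 * M + 4) * cmod z ^ 1" if "1 \<le> cmod z" for z :: complex
  proof -
    \<comment> \<open>The radius is twice \<open>cmod z\<close>, so that rescaling by
      \<open>R\<close> moves \<open>z\<close> to a point of modulus 1/2; \<open>A\<close> strictly
      bounds \<open>Re h\<close> on the disc of radius \<open>R\<close>.\<close>
    define R where "R = 2 * cmod z"
    define A where "A = M + R"
    have R: "R > 0" and A: "A > 0" using that M0 by (auto simp: R_def A_def)
    have below: "Re (h (R * u)) < A" if "cmod u < 1" for u :: complex
    proof -
      have "Re (h (R * u)) \<le> M + R * cmod u"
        using Re_h[of "R * u"] R by (simp add: norm_mult)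
      also have "\<dots> < A" using that R by (simp add: A_def)
      finally show ?thesis .
    qed
    then have den: "2 * complex_of_real A - h (R * u) \<noteq> 0" if "cmod u < 1" for u :: complex
      using that A by (auto simp: complex_eq_iff dest: below)
    \<comment> \<open>Borel--Caratheodory: the Moebius map \<open>w \<mapsto> w / (2A - w)\<close> takes \<open>Re w < A\<close> into the disc.\<close>
    define w where "w = (\<lambda>u::complex. h (R * u) / (2 * complex_of_real A - h (R * u)))"
    have w_lt: "cmod (w u) < 1" if "cmod u < 1" for u :: complex
    proof -
      \<comment> \<open>The difference of the two squares is
        \<open>4 * A * (A - Re (h (R * u)))\<close>.\<close>
      have "(cmod (h (R * u)))\<^sup>2 < (cmod (2 * complex_of_real A - h (R * u)))\<^sup>2"
        using mult_pos_pos[of A "A - Re (h (R * u))"] A below[OF that]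
        unfolding cmod_power2 by (simp add: power2_eq_square algebra_simps)
      then have "cmod (h (R * u)) < cmod (2 * complex_of_real A - h (R * u))"
        by (rule power2_less_imp_less) simp
      then show ?thesis
        by (simp add: w_def norm_divide divide_simps)
    qed
    have "(\<lambda>u. h (R * u)) holomorphic_on ball 0 1"
      by (rule holomorphic_on_compose_gen[OF _ holh, unfolded o_def]) (auto intro!: holomorphic_intros)
    moreover have "2 * complex_of_real A - h (R * u) \<noteq> 0" if "u \<in> ball 0 1" for u :: complex
      using that by (intro den) simp
    ultimately have holw: "w holomorphic_on ball 0 1"
      unfolding w_def by (intro holomorphic_on_divide holomorphic_on_diff holomorphic_on_const)
    define u where "u = z / R"
    have "z \<noteq> 0" using that by auto
    then have u: "cmod u = 1/2" and Ru: "R * u = z" using R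
      by (auto simp: u_def R_def norm_divide norm_mult)
    have half: "cmod (w u) \<le> 1/2"
      using Schwarz_Lemma(1)[OF holw _ w_lt, of u] u by (simp add: w_def h0)
    \<comment> \<open>Inverting the Moebius map recovers \<open>h z\<close> from \<open>w u\<close>;
      the Schwarz bound 1/2 keeps \<open>1 + w u\<close> away from 0.\<close>
    have "h z * (1 + w u) = 2 * complex_of_real A * w u"
      using den[of u] u unfolding w_def Ru by (simp add: field_simps)
    then have eq: "cmod (h z) * cmod (1 + w u) = 2 * A * cmod (w u)"
      unfolding norm_mult[symmetric] using A by (simp add: norm_mult)
    have "1/2 \<le> cmod (1 + w u)"
      using norm_diff_ineq[of 1 "w u"] half by simp
    then have "cmod (h z) * (1/2) \<le> cmod (h z) * cmod (1 + w u)"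
      by (intro mult_left_mono) auto
    also have "\<dots> \<le> 2 * A * (1/2)"
      unfolding eq using half A by (intro mult_left_mono) auto
    finally have "cmod (h z) \<le> 2 * A" by simp
    also have "\<dots> \<le> (2 * M + 4) * cmod z"
      using that M0 mult_left_mono[of 1 "cmod z" "2 * M"] by (simp add: A_def R_def algebra_simps)
    finally show ?thesis by simp
  qed
  \<comment> \<open>Growth of degree 1 leaves a constant and a linear Taylor term, and
    \<open>h 0 = 0\<close> removes the constant.\<close>
  have "h z = deriv h 0 * z" for z :: complex
    using Liouville_polynomial[OF holh, of 1 "2 * M + 4" 1 z, OF h_growth] by (simp add: h0)
  with F_h that show ?thesis by metis
qed

section \<open>Entire functions as elements of the Hardy space\<close>

text \<open>The cut-off matches the representation of \<open>hardy\<close> by functions vanishing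
  off the disc. For entire \<open>g\<close> the cut-off function does lie in
  \<open>hardy_functions\<close>, as \<open>hfun_entire_hardy\<close> confirms.\<close>

definition entire_hardy :: "(complex \<Rightarrow> complex) \<Rightarrow> hardy" where
  "entire_hardy g = Abs_hardy (\<lambda>z. if z \<in> unit_disc then g z else 0)"

lemma taylor_coeff_cong:
  assumes "\<And>z::complex. z \<in> unit_disc \<Longrightarrow> f z = g z"
  shows "taylor_coeff f n = taylor_coeff g n"
proof -
  have "\<forall>\<^sub>F z in nhds 0. z \<in> unit_disc"
    by (intro eventually_nhds_in_open) auto
  then have "\<forall>\<^sub>F z in nhds 0. f z = g z"
    by eventually_elim (rule assms)
  then show ?thesis
    by (simp add: taylor_coeff_def cong: fps_expansion_cong)
qed

text \<open>Cauchy's inequality on a disc of radius larger than 1 gives geometric decay, hence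
  square-summable coefficients.\<close>

lemma taylor_coeff_bound:
  assumes "g holomorphic_on UNIV" "\<And>z::complex. z \<in> cball 0 2 \<Longrightarrow> cmod (g z) \<le> B"
  shows "cmod (taylor_coeff g n) \<le> B / 2 ^ n"
proof -
  have "cmod ((deriv ^^ n) g 0) \<le> fact n * B / 2 ^ n"
  proof (rule Cauchy_inequality)
    show "g holomorphic_on ball 0 2" "continuous_on (cball 0 2) g"
      using assms(1) holomorphic_on_subset holomorphic_on_imp_continuous_on by blast+
  qed (use assms(2) in auto)
  then show ?thesis
    by (simp add: taylor_coeff_def fps_expansion_def norm_divide field_simps)
qed

lemma taylor_coeff_square_bound:
  assumes "g holomorphic_on UNIV" "\<And>z::complex. z \<in> cball 0 2 \<Longrightarrow> cmod (g z) \<le> B"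
  shows "(cmod (taylor_coeff g n))\<^sup>2 \<le> B\<^sup>2 * (1/4) ^ n"
proof -
  have "(cmod (taylor_coeff g n))\<^sup>2 \<le> (B / 2 ^ n)\<^sup>2"
    by (intro power_mono taylor_coeff_bound assms) auto
  also have "\<dots> = B\<^sup>2 * (1/4) ^ n"
  proof -
    have "(2 ^ n)\<^sup>2 = (4 ^ n :: real)"
      by (simp add: power_mult[symmetric] mult.commute[of n] power_mult[of 2 2, simplified])
    then show ?thesis by (simp add: power_divide)
  qed
  finally show ?thesis .
qed

lemma entire_bounded:
  fixes g :: "complex \<Rightarrow> complex"
  assumes "g holomorphic_on UNIV"
  obtains B where "B > 0" "\<And>z::complex. z \<in> cball 0 2 \<Longrightarrow> cmod (g z) \<le> B"
proof -
  have "compact (g ` cball 0 2)"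
    using assms by (intro compact_continuous_image holomorphic_on_imp_continuous_on)
      (auto intro: holomorphic_on_subset)
  then have "bounded (g ` cball 0 2)"
    by (rule compact_imp_bounded)
  then show ?thesis
    using that by (auto simp: bounded_pos)
qed

lemma hfun_entire_hardy:
  assumes "g holomorphic_on UNIV"
  shows "hfun (entire_hardy g) z = (if z \<in> unit_disc then g z else 0)"
proof -
  obtain B where B: "\<And>z::complex. z \<in> cball 0 2 \<Longrightarrow> cmod (g z) \<le> B"
    using entire_bounded[OF assms] by metis
  have "summable (\<lambda>n. (cmod (taylor_coeff g n))\<^sup>2)"
    by (rule summable_comparison_test'[of "\<lambda>n. B\<^sup>2 * (1/4) ^ n"])
      (use taylor_coeff_square_bound[OF assms B] in \<open>auto intro!: summable_mult summable_geometric\<close>)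
  moreover have "taylor_coeff (\<lambda>z. if z \<in> unit_disc then g z else 0) n = taylor_coeff g n" for n
    by (rule taylor_coeff_cong) simp
  moreover have "(\<lambda>z. if z \<in> unit_disc then g z else 0) holomorphic_on unit_disc"
    using holomorphic_on_subset[OF assms]
    by (subst holomorphic_cong[of _ unit_disc _ g]) auto
  ultimately have "(\<lambda>z. if z \<in> unit_disc then g z else 0) \<in> hardy_functions"
    by (simp add: hardy_functions_def)
  then show ?thesis
    by (simp add: entire_hardy_def Abs_hardy_inverse)
qed

lemma taylor_coeff_entire_hardy:
  "g holomorphic_on UNIV \<Longrightarrow> taylor_coeff (hfun (entire_hardy g)) n = taylor_coeff g n"
  by (rule taylor_coeff_cong) (simp add: hfun_entire_hardy)

text \<open>Turns uniform approximation on the larger disc into approximation in the Hardy norm.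
  Summing the squared Cauchy bounds gives \<open>4/3 * B\<^sup>2\<close>, which is rounded up to
  \<open>(2 * B)\<^sup>2\<close>.\<close>

lemma norm_hardy_le:
  assumes "g holomorphic_on UNIV" "\<And>z::complex. z \<in> cball 0 2 \<Longrightarrow> cmod (g z) \<le> B"
    "\<And>z::complex. z \<in> unit_disc \<Longrightarrow> hfun f z = g z"
  shows "norm f \<le> 2 * B"
proof -
  have B: "B \<ge> 0" using order_trans[OF norm_ge_zero assms(2)[of 0]] by simp
  have eq: "taylor_coeff (hfun f) n = taylor_coeff g n" for n
    by (rule taylor_coeff_cong) (simp add: assms)
  have "(\<lambda>n. B\<^sup>2 * (1/4) ^ n) sums (B\<^sup>2 * (1 / (1 - 1/4)))"
    by (intro sums_mult geometric_sums) simp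
  then have "(\<Sum>n. (cmod (taylor_coeff (hfun f) n))\<^sup>2) \<le> B\<^sup>2 * (1 / (1 - 1/4))"
    unfolding eq using summable_hfun[of f, unfolded eq]
    by (intro sums_le[OF taylor_coeff_square_bound[OF assms(1,2)] summable_sums])
  also have "\<dots> \<le> (2 * B)\<^sup>2"
    by (simp add: power2_eq_square)
  finally show ?thesis
    unfolding norm_hardy_def using B by (intro real_le_lsqrt) auto
qed

section \<open>Expansion in the monomials\<close>

definition zpow :: "nat \<Rightarrow> hardy" where
  "zpow n = entire_hardy (\<lambda>z. z ^ n)"

lemma hfun_zpow: "z \<in> unit_disc \<Longrightarrow> hfun (zpow n) z = z ^ n"
  by (auto simp: zpow_def hfun_entire_hardy holomorphic_intros)

lemma taylor_coeff_zpow: "taylor_coeff (hfun (zpow n)) k = (if k = n then 1 else 0)"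
proof -
  have "(\<lambda>z. z ^ n) has_fps_expansion (fps_X ^ n :: complex fps)"
    by (intro fps_expansion_intros)
  then have "taylor_coeff (\<lambda>z. z ^ n) k = (if k = n then 1 else 0)"
    by (simp add: taylor_coeff_eqI fps_X_power_nth)
  then show ?thesis
    by (simp add: zpow_def taylor_coeff_entire_hardy holomorphic_intros)
qed

lemma taylor_coeff_hfun_scaleC:
  "taylor_coeff (hfun (scaleC c f)) n = c * taylor_coeff (hfun f) n"
  using taylor_coeff_cmult[OF hfun_holomorphic, of c f n] by (simp add: scaleC.rep_eq)

lemma taylor_coeff_hfun_diff:
  "taylor_coeff (hfun (f - g)) n = taylor_coeff (hfun f) n - taylor_coeff (hfun g) n"
  using taylor_coeff_hfun_add[of "f - g" g n] by simp

lemma taylor_coeff_hfun_sum: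
  "taylor_coeff (hfun (\<Sum>i\<in>I. f i)) n = (\<Sum>i\<in>I. taylor_coeff (hfun (f i)) n)"
proof (induction I rule: infinite_finite_induct)
  case (insert i I)
  then show ?case by (simp add: taylor_coeff_hfun_add del: hfun_simps)
qed (simp_all add: zero_hardy.rep_eq)

lemma hfun_sum: "hfun (\<Sum>i\<in>I. f i) z = (\<Sum>i\<in>I. hfun (f i) z)"
  by (induction I rule: infinite_finite_induct) simp_all

lemma norm_hardy_power2: "(norm f)\<^sup>2 = (\<Sum>n. (cmod (taylor_coeff (hfun f) n))\<^sup>2)"
  unfolding norm_hardy_def by (simp add: suminf_nonneg summable_hfun)

lemma norm_taylor_coeff_le: "cmod (taylor_coeff (hfun f) n) \<le> norm f"
proof -
  have "(\<Sum>k\<in>{n}. (cmod (taylor_coeff (hfun f) k))\<^sup>2) \<le> (norm f)\<^sup>2"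
    unfolding norm_hardy_power2 by (intro sum_le_suminf summable_hfun) auto
  then have "(cmod (taylor_coeff (hfun f) n))\<^sup>2 \<le> (norm f)\<^sup>2"
    by simp
  then show ?thesis
    by (rule power2_le_imp_le) simp
qed

lemma taylor_coeff_zpow_sum:
  "taylor_coeff (hfun (\<Sum>n<N. scaleC (a n) (zpow n))) k = (if k < N then a k else 0)"
  by (simp add: taylor_coeff_hfun_sum taylor_coeff_hfun_scaleC taylor_coeff_zpow if_distrib
      cong: if_cong)

text \<open>By Parseval, the squared distance from \<open>f\<close> to the \<open>N\<close>-th
  partial sum is a tail of the convergent series of squared coefficients.\<close>

lemma zpow_sums: "(\<lambda>n. scaleC (taylor_coeff (hfun f) n) (zpow n)) sums f"
proof -
  define a where "a = taylor_coeff (hfun f)"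
  define s where "s N = (\<Sum>n<N. scaleC (a n) (zpow n))" for N
  have summ: "summable (\<lambda>n. (cmod (a n))\<^sup>2)"
    using summable_hfun by (simp add: a_def)
  have "(norm (s N - f))\<^sup>2 = (\<Sum>n. (cmod (a n))\<^sup>2) - (\<Sum>n<N. (cmod (a n))\<^sup>2)" for N
  proof -
    have c: "(cmod (taylor_coeff (hfun (s N - f)) k))\<^sup>2 =
      (cmod (a k))\<^sup>2 - (if k \<in> {..<N} then (cmod (a k))\<^sup>2 else 0)" for k
      by (simp add: s_def taylor_coeff_hfun_diff taylor_coeff_zpow_sum a_def)
    have "(\<lambda>k. (cmod (a k))\<^sup>2 - (if k \<in> {..<N} then (cmod (a k))\<^sup>2 else 0)) sums
      ((\<Sum>n. (cmod (a n))\<^sup>2) - (\<Sum>n<N. (cmod (a n))\<^sup>2))"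
      using summ by (intro sums_diff sums_If_finite_set summable_sums) auto
    then show ?thesis
      unfolding norm_hardy_power2 c by (rule sums_unique[symmetric])
  qed
  moreover have "(\<lambda>N. (\<Sum>n. (cmod (a n))\<^sup>2) - (\<Sum>n<N. (cmod (a n))\<^sup>2)) \<longlonglongrightarrow>
      (\<Sum>n. (cmod (a n))\<^sup>2) - (\<Sum>n. (cmod (a n))\<^sup>2)"
    by (intro tendsto_intros summable_LIMSEQ summ)
  ultimately have "(\<lambda>N. sqrt ((norm (s N - f))\<^sup>2)) \<longlonglongrightarrow> sqrt 0"
    by (intro tendsto_real_sqrt) simp
  then have "(\<lambda>N. norm (s N - f)) \<longlonglongrightarrow> 0"
    by simp
  then have "s \<longlonglongrightarrow> f"
    by (simp add: LIM_zero_cancel tendsto_norm_zero_iff)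
  then show ?thesis
    unfolding sums_def s_def a_def .
qed

section \<open>Zero-free entire functions are outer\<close>

text \<open>Taylor polynomials converge uniformly on compact sets; the disc of radius 2 is the one
  on which \<open>norm_hardy_le\<close> needs control.\<close>

lemma entire_poly_approx:
  assumes "g holomorphic_on UNIV" "e > 0"
  obtains p :: "complex poly" where "\<And>z::complex. z \<in> cball 0 2 \<Longrightarrow> cmod (poly p z - g z) < e"
proof -
  define a where "a = fps_nth (fps_expansion g 0)"
  have hol: "g holomorphic_on eball 0 \<infinity>"
    using assms(1) by (rule holomorphic_on_subset) simp
  have "conv_radius a = \<infinity>"
    using conv_radius_fps_expansion[OF hol] by (simp add: a_def fps_conv_radius_def)
  then have "uniform_limit (cball 0 2) (\<lambda>n x. \<Sum>i<n. a i * (x - 0) ^ i)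
      (\<lambda>x. suminf (\<lambda>i. a i * (x - 0) ^ i)) sequentially"
    by (intro powser_uniform_limit) simp
  moreover have "suminf (\<lambda>i. a i * (x - 0) ^ i) = g x" for x
    using eval_fps_expansion[OF hol, of x] by (simp add: eval_fps_def a_def)
  ultimately have "\<forall>\<^sub>F n in sequentially. \<forall>x\<in>cball 0 2. dist (\<Sum>i<n. a i * x ^ i) (g x) < e"
    using assms(2) by (simp add: uniform_limit_iff)
  then obtain n where "\<forall>x\<in>cball 0 2. dist (\<Sum>i<n. a i * x ^ i) (g x) < e"
    by (auto simp: eventually_sequentially)
  then show ?thesis
    by (intro that[of "\<Sum>i<n. monom (a i) i"]) (simp add: poly_sum poly_monom dist_norm)
qed

text \<open>A target \<open>f\<close> is first replaced by a Taylor polynomial \<open>q\<close>. As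
  \<open>q / g\<close> is entire, a polynomial \<open>p\<close> approximates it on the disc of
  radius 2; then \<open>p * g\<close> is close to \<open>q\<close> and is a combination of shifts of
  \<open>g\<close>.\<close>

lemma outer_entire_hardy:
  assumes hol: "g holomorphic_on UNIV" and nz: "\<And>z. g z \<noteq> 0"
  shows "entire_hardy g \<in> outer"
proof -
  define G where "G = entire_hardy g"
  define V where "V = hardy.span {(shift ^^ n) G | n. True}"
  obtain B where B: "B > 0" "\<And>z::complex. z \<in> cball 0 2 \<Longrightarrow> cmod (g z) \<le> B"
    using entire_bounded[OF hol] by metis
  have "\<exists>h\<in>V. dist h f < e" if e: "e > 0" for f e
  proof -
    define s where "s N = (\<Sum>n<N. scaleC (taylor_coeff (hfun f) n) (zpow n))" for N
    have "s \<longlonglongrightarrow> f"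
      using zpow_sums[of f] unfolding sums_def s_def .
    then have "\<forall>\<^sub>F N in sequentially. dist (s N) f < e / 2"
      using e by (intro tendstoD) auto
    then obtain N where N: "dist (s N) f < e / 2"
      by (auto simp: eventually_sequentially)
    define q where "q z = (\<Sum>n<N. taylor_coeff (hfun f) n * z ^ n)" for z
    have holq: "q holomorphic_on UNIV"
      unfolding q_def by (intro holomorphic_intros)
    have "(\<lambda>z. q z / g z) holomorphic_on UNIV"
      by (intro holomorphic_intros hol holq nz)
    \<comment> \<open>With \<open>cmod (g z) \<le> B\<close>, this tolerance gives
      \<open>e / 4\<close> for \<open>p * g - q\<close>; the factor 2 of
      \<open>norm_hardy_le\<close> makes it \<open>e / 2\<close>, the other half of the error being
      that of \<open>s N\<close>.\<close>
    then obtain p where p: "\<And>z::complex. z \<in> cball 0 2 \<Longrightarrow> cmod (poly p z - q z / g z) < e / (4 * B)"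
      using entire_poly_approx[of "\<lambda>z. q z / g z" "e / (4 * B)"] e B(1) by auto
    define h where "h = (\<Sum>i\<le>degree p. scaleC (coeff p i) ((shift ^^ i) G))"
    have "h \<in> V"
      unfolding h_def V_def
      by (intro hardy.span_sum hardy.span_scale hardy.span_base) blast
    moreover have "norm (h - s N) \<le> 2 * (e / 4)"
    proof (rule norm_hardy_le)
      show "(\<lambda>z. poly p z * g z - q z) holomorphic_on UNIV"
        by (intro holomorphic_intros hol holq)
      show "cmod (poly p z * g z - q z) \<le> e / 4" if "z \<in> cball 0 2" for z
      proof -
        have "poly p z * g z - q z = (poly p z - q z / g z) * g z"
          using nz by (simp add: field_simps)
        then have "cmod (poly p z * g z - q z) = cmod (poly p z - q z / g z) * cmod (g z)"
          by (simp only: norm_mult)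
        also have "\<dots> \<le> e / (4 * B) * B"
          using e B(1) by (intro mult_mono less_imp_le[OF p[OF that]] B(2)[OF that]) auto
        finally show ?thesis using B(1) by simp
      qed
      show "hfun (h - s N) z = poly p z * g z - q z" if "z \<in> unit_disc" for z
        using that by (simp add: h_def s_def q_def hfun_sum hfun_zpow hfun_funpow_shift G_def
            hfun_entire_hardy hol poly_altdef sum_distrib_right mult.assoc)
    qed
    then have "dist h f < e"
      using N dist_triangle[of h f "s N"] by (simp add: dist_norm)
    ultimately show ?thesis by blast
  qed
  then have "closure V = UNIV"
    by (auto simp: closure_approachable)
  then show ?thesis
    by (simp add: outer_def V_def G_def)
qed

section \<open>Point evaluations and zeros of outer functions\<close>

text \<open>Every Taylor coefficient is at most the norm, so a geometric series dominates the Taylor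
  series.\<close>

lemma norm_hfun_le:
  assumes "z \<in> unit_disc"
  shows "cmod (hfun f z) \<le> norm f / (1 - cmod z)"
proof -
  have z: "cmod z < 1" using assms by simp
  have le: "cmod (taylor_coeff (hfun f) n * z ^ n) \<le> norm f * cmod z ^ n" for n
    unfolding norm_mult norm_power by (intro mult_right_mono norm_taylor_coeff_le) auto
  have g: "(\<lambda>n. norm f * cmod z ^ n) sums (norm f * (1 / (1 - cmod z)))"
    by (intro sums_mult geometric_sums) (simp add: z)
  have "hfun f z = (\<Sum>n. taylor_coeff (hfun f) n * z ^ n)"
    using taylor_sums[OF hfun_holomorphic assms, of f] by (rule sums_unique)
  also have "cmod \<dots> \<le> (\<Sum>n. norm f * cmod z ^ n)"
    by (rule norm_suminf_le[OF le sums_summable[OF g]])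
  also have "\<dots> = norm f / (1 - cmod z)"
    using g by (simp add: sums_iff)
  finally show ?thesis .
qed

lemma bounded_linear_hfun:
  assumes "z \<in> unit_disc"
  shows "bounded_linear (\<lambda>f. hfun f z)"
  by (rule bounded_linear_intro[of _ "1 / (1 - cmod z)"])
    (use norm_hfun_le[OF assms] in \<open>auto simp: scaleR_conv_of_real\<close>)

text \<open>A zero at \<open>z\<close> is inherited by all shifts of \<open>f\<close>, their span
  and, by continuity of evaluation, its closure; the constant function 1 would be missed.\<close>

lemma outer_nonzero:
  assumes "f \<in> outer" "z \<in> unit_disc"
  shows "hfun f z \<noteq> 0"
proof
  assume f0: "hfun f z = 0"
  define W where "W = {g. hfun g z = 0}"
  have "hardy.span {(shift ^^ n) f | n. True} \<subseteq> W"
    by (rule hardy.span_minimal)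
      (auto simp: W_def hfun_funpow_shift f0 hardy.subspace_def)
  moreover have "closed W"
    unfolding W_def
    by (intro closed_Collect_eq continuous_intros linear_continuous_on bounded_linear_hfun assms)
  ultimately have "closure (hardy.span {(shift ^^ n) f | n. True}) \<subseteq> W"
    by (rule closure_minimal)
  then have "zpow 0 \<in> W"
    using assms(1) by (auto simp: outer_def)
  then show False
    using assms(2) by (simp add: W_def hfun_zpow)
qed

section \<open>Functionals without zeros on the outer functions\<close>

text \<open>An analogue of the Gleason-Kahane-Zelazko theorem, with outer functions in the role of
  invertible elements.\<close>

lemma functional_nonzero_on_outer:
  fixes L :: "hardy \<Rightarrow> complex"
  assumes bl: "bounded_linear L" and scale: "\<And>c f. L (scaleC c f) = c * L f"
    and nz: "\<And>f. f \<in> outer \<Longrightarrow> L f \<noteq> 0"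
  obtains b where "b \<in> unit_disc" "\<And>f. L f = L (zpow 0) * hfun f b"
proof -
  interpret L: bounded_linear L by fact
  obtain K where K: "K \<ge> 0" "\<And>f. cmod (L f) \<le> norm f * K"
    using L.nonneg_bounded by blast
  define m where "m n = L (zpow n)" for n
  have L_sums: "(\<lambda>n. taylor_coeff (hfun f) n * m n) sums L f" for f
    using L.sums[OF zpow_sums[of f]] by (simp add: scale m_def)
  have m_bound: "cmod (m n) \<le> K" for n
  proof -
    have "(norm (zpow n))\<^sup>2 = (\<Sum>k. if k = n then 1 else 0)"
      unfolding norm_hardy_power2 taylor_coeff_zpow by (intro suminf_cong) simp
    also have "\<dots> = 1"
      using sums_single[of n "\<lambda>_. 1::real"] by (simp add: sums_iff)
    finally have "norm (zpow n) = 1"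
      by (simp add: power2_eq_1_iff) (metis norm_ge_zero not_one_le_zero neg_0_le_iff_le)
    then show ?thesis
      using K(2)[of "zpow n"] by (simp add: m_def)
  qed
  define E where "E l = entire_hardy (\<lambda>z. exp (l * z))" for l :: complex
  define F where "F l = L (E l)" for l :: complex
  have E_coeff: "taylor_coeff (hfun (E l)) n = l ^ n / fact n" for l :: complex and n
  proof -
    have "(\<lambda>z. exp (l * z)) has_fps_expansion fps_exp l"
      by (intro fps_expansion_intros)
    then show ?thesis
      unfolding E_def by (subst taylor_coeff_entire_hardy)
        (auto intro!: holomorphic_intros simp: taylor_coeff_eqI)
  qed
  \<comment> \<open>\<open>F\<close> is the exponential generating function of the moments
    \<open>m n\<close>; as these are bounded by \<open>K\<close>, it has exponential type at most
    1.\<close>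
  have F_sums: "(\<lambda>n. m n / fact n * l ^ n) sums F l" for l :: complex
    using L_sums[of "E l"] by (simp add: E_coeff F_def mult_ac)
  have F_nz: "F l \<noteq> 0" for l :: complex
    unfolding F_def E_def by (intro nz outer_entire_hardy holomorphic_intros) auto
  have F_bound: "cmod (F l) \<le> K * exp (cmod l)" for l :: complex
  proof -
    have g: "(\<lambda>n. K * (cmod l ^ n /\<^sub>R fact n)) sums (K * exp (cmod l))"
      by (intro sums_mult exp_converges)
    have "cmod (F l) = cmod (\<Sum>n. m n / fact n * l ^ n)"
      using F_sums[of l] by (simp add: sums_iff)
    also have "\<dots> \<le> (\<Sum>n. K * (cmod l ^ n /\<^sub>R fact n))"
    proof (rule norm_suminf_le[OF _ sums_summable[OF g]])
      show "cmod (m n / fact n * l ^ n) \<le> K * (cmod l ^ n /\<^sub>R fact n)" for n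
        using mult_right_mono[OF m_bound[of n], of "cmod l ^ n / fact n"]
        by (simp add: norm_mult norm_divide norm_power divide_inverse mult_ac norm_inverse)
    qed
    finally show ?thesis using g by (simp add: sums_iff)
  qed
  define P where "P = Abs_fps (\<lambda>n. m n / fact n)"
  have rad: "fps_conv_radius P = \<infinity>"
    unfolding fps_conv_radius_def P_def
    by (intro conv_radius_inftyI'') (use F_sums in \<open>auto simp: sums_iff\<close>)
  have F_eval: "F = eval_fps P"
    using F_sums by (auto simp: eval_fps_def P_def sums_iff)
  have "F holomorphic_on UNIV"
    unfolding F_eval by (intro holomorphic_intros) (simp add: rad)
  then obtain b where b: "\<And>l::complex. F l = F 0 * exp (b * l)"
    using zero_free_exponential_type[OF _ F_nz F_bound] by metis
  have F0: "F 0 = m 0"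
    using F_sums[of 0] powser_sums_zero[of "\<lambda>n. m n / fact n"] by (simp add: sums_unique2)
  have m0: "m 0 \<noteq> 0" using F_nz[of 0] F0 by simp
  \<comment> \<open>Uniqueness of power series: the factors \<open>1 / fact n\<close> on both sides
    cancel.\<close>
  have m: "m n = m 0 * b ^ n" for n
  proof -
    have "F has_fps_expansion P"
      unfolding F_eval by (intro has_fps_expansionI) (use F_sums in \<open>auto simp: P_def F_eval\<close>)
    moreover have "(\<lambda>l. m 0 * exp (b * l)) has_fps_expansion (fps_const (m 0) * fps_exp b)"
      by (intro fps_expansion_intros)
    moreover have "F = (\<lambda>l. m 0 * exp (b * l))"
      using b F0 by auto
    ultimately have "P = fps_const (m 0) * fps_exp b"
      by (metis fps_expansion_unique_complex)
    then have "fps_nth P n = m 0 * (b ^ n / fact n)"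
      by simp
    then show ?thesis by (simp add: P_def)
  qed
  \<comment> \<open>Testing \<open>L\<close> on truncated reproducing kernels gives
    \<open>cmod (m 0) * T \<le> K * sqrt T\<close>, where \<open>T\<close> is this partial sum.
    Hence the partial sums are bounded uniformly in \<open>N\<close>, which forces
    \<open>cmod b < 1\<close>.\<close>
  have "(\<Sum>n<N. (cmod b)\<^sup>2 ^ n) \<le> (K / cmod (m 0))\<^sup>2" for N
  proof -
    define T where "T = (\<Sum>n<N. (cmod b)\<^sup>2 ^ n)"
    \<comment> \<open>partial sum of the kernel at \<open>b\<close>: its squared norm and \<open>L f / m 0\<close> are both \<open>T\<close>\<close>
    define f where "f = (\<Sum>n<N. scaleC (cnj b ^ n) (zpow n))"
    have bb: "cnj b ^ n * b ^ n = of_real ((cmod b)\<^sup>2 ^ n)" for n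
      unfolding of_real_power[of _ n] complex_norm_square by (simp add: power_mult_distrib mult.commute)
    have "L f = (\<Sum>n<N. cnj b ^ n * m n)"
      by (simp add: f_def L.sum scale m_def)
    also have "\<dots> = (\<Sum>n<N. m 0 * of_real ((cmod b)\<^sup>2 ^ n))"
      by (intro sum.cong refl, subst m) (metis bb mult.left_commute)
    also have "\<dots> = m 0 * of_real T"
      by (simp add: T_def sum_distrib_left)
    finally have Lf: "L f = m 0 * of_real T" .
    have "(\<lambda>k. if k \<in> {..<N} then (cmod b)\<^sup>2 ^ k else 0) sums T"
      unfolding T_def by (intro sums_If_finite_set) simp
    moreover have "(cmod (taylor_coeff (hfun f) k))\<^sup>2 = (if k \<in> {..<N} then (cmod b)\<^sup>2 ^ k else 0)" for k
      by (simp add: f_def taylor_coeff_zpow_sum norm_power power_mult[symmetric] mult.commute)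
    ultimately have "(norm f)\<^sup>2 = T"
      by (simp add: norm_hardy_power2 sums_iff)
    have T0: "T \<ge> 0"
      by (simp add: T_def sum_nonneg)
    have "cmod (m 0) * T \<le> norm f * K"
      using K(2)[of f] T0 by (simp add: Lf norm_mult)
    then have "(cmod (m 0) * T)\<^sup>2 \<le> T * K\<^sup>2"
      using T0 power_mono[of "cmod (m 0) * T" "norm f * K" 2] \<open>(norm f)\<^sup>2 = T\<close>
      by (simp add: power_mult_distrib)
    then have "T * (T * (cmod (m 0))\<^sup>2) \<le> T * K\<^sup>2"
      by (simp add: power2_eq_square mult_ac)
    then have "T * (cmod (m 0))\<^sup>2 \<le> K\<^sup>2"
      using T0 by (cases "T = 0") auto
    then show ?thesis
      using m0 by (simp add: T_def power_divide pos_le_divide_eq)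
  qed
  then have "summable (\<lambda>n. (cmod b)\<^sup>2 ^ n)"
    by (intro summableI_nonneg_bounded) auto
  then have "cmod b < 1"
    by (simp add: summable_geometric_iff power_less_one_iff abs_square_less_1)
  then have b_disc: "b \<in> unit_disc" by simp
  have "L f = m 0 * hfun f b" for f
  proof -
    have "(\<lambda>n. m 0 * (taylor_coeff (hfun f) n * b ^ n)) sums (m 0 * hfun f b)"
      by (intro sums_mult taylor_sums hfun_holomorphic b_disc)
    moreover have "(\<lambda>n. m 0 * (taylor_coeff (hfun f) n * b ^ n)) sums L f"
      using L_sums[of f] by (subst (asm) m) (simp add: mult_ac)
    ultimately show ?thesis by (rule sums_unique2[symmetric])
  qed
  then show ?thesis
    unfolding m_def by (rule that[OF b_disc])
qed

section \<open>The operator as a weighted composition\<close>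

theorem theorem3:
  fixes A :: "hardy \<Rightarrow> hardy"
  assumes "bounded_linear A"
    and "Vector_Spaces.linear scaleC scaleC A"
    and "A ` outer \<subseteq> outer"
  shows "\<exists>\<phi> \<psi>. \<phi> holomorphic_on unit_disc \<and> \<phi> ` unit_disc \<subseteq> unit_disc \<and> \<psi> \<in> outer \<and>
           (\<forall>f. \<forall>z\<in>unit_disc. hfun (A f) z = hfun \<psi> z * hfun f (\<phi> z))"
proof -
  \<comment> \<open>The desired formula, applied to the constant 1 and to the coordinate function,
    dictates these choices. As a quotient, \<open>\<phi>\<close> is holomorphic once
    \<open>\<psi>\<close> is known to be zero-free.\<close>
  define \<psi> where "\<psi> = A (zpow 0)"
  define \<phi> where "\<phi> z = hfun (A (zpow 1)) z / hfun \<psi> z" for z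
  have "zpow 0 \<in> outer"
    unfolding zpow_def by (rule outer_entire_hardy) auto
  then have \<psi>: "\<psi> \<in> outer"
    using assms(3) by (auto simp: \<psi>_def)
  have main: "\<phi> z \<in> unit_disc \<and> (\<forall>f. hfun (A f) z = hfun \<psi> z * hfun f (\<phi> z))"
    if z: "z \<in> unit_disc" for z
  proof -
    have bl: "bounded_linear (\<lambda>f. hfun (A f) z)"
      by (rule bounded_linear_compose[OF bounded_linear_hfun[OF z] assms(1)])
    have scale: "hfun (A (scaleC c f)) z = c * hfun (A f) z" for c f
      using assms(2) by (simp add: Vector_Spaces.linear_iff)
    have nz: "hfun (A f) z \<noteq> 0" if "f \<in> outer" for f
      using that assms(3) z by (intro outer_nonzero) auto
    have "\<exists>b\<in>unit_disc. \<forall>f. hfun (A f) z = hfun (A (zpow 0)) z * hfun f b"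
    proof (rule functional_nonzero_on_outer[OF bl scale nz])
      fix b
      assume "b \<in> unit_disc" "\<And>f. hfun (A f) z = hfun (A (zpow 0)) z * hfun f b"
      then show ?thesis by blast
    qed
    then obtain b where b: "b \<in> unit_disc" and Ab: "\<And>f. hfun (A f) z = hfun \<psi> z * hfun f b"
      unfolding \<psi>_def by blast
    \<comment> \<open>Evaluating the formula at the coordinate function identifies the point
      \<open>b\<close>, obtained separately for each \<open>z\<close>, with the value of
      \<open>\<phi>\<close>.\<close>
    have "\<phi> z = b"
      using Ab[of "zpow 1"] b outer_nonzero[OF \<psi> z] by (simp add: \<phi>_def hfun_zpow del: mem_ball)
    then show ?thesis using b Ab by simp
  qed
  have "\<phi> holomorphic_on unit_disc"
    unfolding \<phi>_def by (intro holomorphic_intros hfun_holomorphic outer_nonzero \<psi>)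
  then show ?thesis
    using main \<psi> by blast
qed

end
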